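(* $$\mathsf{CT}^{\mathsf{obl}}_{\forall\forall}=\mathsf{CT}^{\mathsf{obl}}_{\forall\exists}\subset\mathsf{CT}^{\mathsf{sobl}}_{\forall\forall}=\mathsf{CT}^{\mathsf{sobl}}_{\forall\exists}\subset\mathsf{CT}^{\mathsf{std}}_{\forall\forall}\subset\mathsf{CT}^{\mathsf{std}}_{\forall\exists},$$ where $\subset$ denotes proper inclusion.
   Context: Let $\mathsf{Cons}$ (constants), $\mathsf{Nulls}$ (nulls) and $\mathsf{Vars}$ (variables) be pairwise disjoint countably infinite sets. A schema is a finite set of relation symbols, each with a positive arity. An instance is a finite set of atoms $R(a_1,\dots,a_k)$ with $a_i\in\mathsf{Cons}\cup\mathsf{Nulls}$. A tgd $\xi=\alpha\to\beta$ is a sentence $\forall\bar x,\bar y\,(\alpha(\bar x,\bar y)\to\exists\bar z\,\beta(\bar x,\bar z))$, with body $\alpha$ and head $\beta$ conjunctions of relational atoms over variables and constants; $\bar x$ are the universal variables occurring in both body and head, $\bar y$ those occurring only in the body. Sets of tgds are finite. A trigger for $\Sigma$ on $I$ is a pair $(\xi,h)$ with $\xi=\alpha\to\beta\in\Sigma$ and $h$ a mapping of the universal variables of $\xi$ to $\mathsf{Cons}\cup\mathsf{Nulls}$ (identity on constants) with $h(\alpha)\subseteq I$. It is active on $I$ if no extension $h'$ of $h$ satisfies $h'(\beta)\subseteq I$. Firing it transforms $I$ into $J=I\cup h'(\beta)$, where $h'$ extends $h$ by assigning new fresh nulls to the existential variables. A chase sequence from $I_0=I$ with $\Sigma$ is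 a finite or infinite sequence $I_0,I_1,\dots$ in which each $I_{i+1}$ is obtained from $I_i$ by firing an applicable trigger. It terminates if some $I_i$ has no applicable trigger left. Applicable triggers are: - standard chase ($\mathsf{std}$): triggers active on the current instance; - oblivious chase ($\mathsf{obl}$): all triggers (active or not) on the current instance that have not already been fired in the sequence; - semi-oblivious chase ($\mathsf{sobl}$): as oblivious, except that triggers $(\xi,h)$ and $(\xi,g)$ are equivalent if $h(\bar x)=g(\bar x)$, and exactly one trigger from each equivalence class is fired in a sequence. All chase sequences are assumed fair: in an infinite sequence, a trigger applicable at some step is, at some later step, fired or no longer applicable. For $\star\in\{\mathsf{std},\mathsf{obl},\mathsf{sobl}\}$, $\mathsf{CT}^\star_{\forall\forall}$ (respectively $\mathsf{CT}^\star_{\forall\exists}$) is the class of all sets $\Sigma$ of tgds such that for every instance $I$, all (respectively some) $\star$-chase sequences with $\Sigma$ on $I$ terminate. *)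

theory Defs
  imports Main "HOL-Library.Extended_Nat"
begin

section \<open>Instances and tuple-generating dependencies\<close>

text \<open>
  Constants, nulls and variables are three copies of the natural numbers, kept disjoint by
  constructors. Instances contain values, dependencies contain terms; the constant
  with index \<open>c\<close> is \<open>Const c\<close> as a value and \<open>Cst c\<close> as a term.
\<close>

datatype val = Const nat | Null nat

datatype trm = Cst nat | Var nat

text \<open>A relation symbol carries its arity, so there are infinitely many symbols of each arity.\<close>

datatype relsym = Rel (rname: nat) (arity: nat)

datatype 'a atom = Atom (rel: relsym) (args: "'a list")

definition schema :: "relsym set \<Rightarrow> bool" where
  "schema S \<longleftrightarrow> finite S \<and> (\<forall>R\<in>S. 0 < arity R)"

definition atom_over :: "relsym set \<Rightarrow> 'a atom \<Rightarrow> bool" where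
  "atom_over S A \<longleftrightarrow> rel A \<in> S \<and> length (args A) = arity (rel A)"

type_synonym inst = "val atom set"

definition instance_over :: "relsym set \<Rightarrow> inst \<Rightarrow> bool" where
  "instance_over S I \<longleftrightarrow> finite I \<and> (\<forall>A\<in>I. atom_over S A)"

definition nulls :: "inst \<Rightarrow> nat set" where
  "nulls I = {n. \<exists>A\<in>I. Null n \<in> set (args A)}"

text \<open>
  Body and head are conjunctions, given as lists of atoms. The quantifier prefix is implicit: the
  variables of the body are universal, the remaining variables of the head are existential.
\<close>

datatype tgd = Tgd (body: "trm atom list") (head: "trm atom list")

definition tgds_over :: "relsym set \<Rightarrow> tgd set \<Rightarrow> bool" where
  "tgds_over S \<Sigma> \<longleftrightarrow>
     finite \<Sigma> \<and> (\<forall>\<xi>\<in>\<Sigma>. \<forall>A \<in> set (body \<xi>) \<union> set (head \<xi>). atom_over S A)"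

definition vars :: "trm atom list \<Rightarrow> nat set" where
  "vars As = {x. \<exists>A\<in>set As. Var x \<in> set (args A)}"

definition universal_vars :: "tgd \<Rightarrow> nat set" where
  "universal_vars \<xi> = vars (body \<xi>)"

definition existential_vars :: "tgd \<Rightarrow> nat set" where
  "existential_vars \<xi> = vars (head \<xi>) - vars (body \<xi>)"

definition frontier_vars :: "tgd \<Rightarrow> nat set" where
  "frontier_vars \<xi> = vars (body \<xi>) \<inter> vars (head \<xi>)"


section \<open>Triggers\<close>

text \<open>
  An assignment is a partial map on variables whose domain is exactly the set of variables it has to
  assign, so that equality of triggers is equality of the tgd and of the values of its universal
  variables.
\<close>

type_synonym assignment = "nat \<rightharpoonup> val"

fun eval_trm :: "assignment \<Rightarrow> trm \<Rightarrow> val" where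
  "eval_trm h (Cst c) = Const c"
| "eval_trm h (Var x) = the (h x)"

definition image_atoms :: "assignment \<Rightarrow> trm atom list \<Rightarrow> inst" where
  "image_atoms h As = map_atom (eval_trm h) ` set As"

type_synonym trigger = "tgd \<times> assignment"

definition is_trigger :: "tgd set \<Rightarrow> inst \<Rightarrow> trigger \<Rightarrow> bool" where
  "is_trigger \<Sigma> I \<tau> \<longleftrightarrow> (case \<tau> of (\<xi>, h) \<Rightarrow>
     \<xi> \<in> \<Sigma> \<and> dom h = universal_vars \<xi> \<and> image_atoms h (body \<xi>) \<subseteq> I)"

definition extension :: "tgd \<Rightarrow> assignment \<Rightarrow> assignment \<Rightarrow> bool" where
  "extension \<xi> h h' \<longleftrightarrow> h \<subseteq>\<^sub>m h' \<and> dom h' = universal_vars \<xi> \<union> existential_vars \<xi>"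

definition active :: "inst \<Rightarrow> trigger \<Rightarrow> bool" where
  "active I \<tau> \<longleftrightarrow> (case \<tau> of (\<xi>, h) \<Rightarrow>
     \<not> (\<exists>h'. extension \<xi> h h' \<and> image_atoms h' (head \<xi>) \<subseteq> I))"

definition fires :: "trigger \<Rightarrow> inst \<Rightarrow> inst \<Rightarrow> bool" where
  "fires \<tau> I J \<longleftrightarrow> (case \<tau> of (\<xi>, h) \<Rightarrow>
     \<exists>h'. extension \<xi> h h' \<and>
          inj_on h' (existential_vars \<xi>) \<and>
          (\<forall>z\<in>existential_vars \<xi>. \<exists>n. h' z = Some (Null n) \<and> n \<notin> nulls I) \<and>
          J = I \<union> image_atoms h' (head \<xi>))"

definition equivalent_triggers :: "trigger \<Rightarrow> trigger \<Rightarrow> bool" where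
  "equivalent_triggers \<tau> \<sigma> \<longleftrightarrow>
     fst \<tau> = fst \<sigma> \<and> (\<forall>x\<in>frontier_vars (fst \<tau>). snd \<tau> x = snd \<sigma> x)"


section \<open>Chase sequences\<close>

datatype chase_variant = Std | Obl | Sobl

text \<open>
  The set \<open>F\<close> consists of the triggers already fired in the sequence.
\<close>

fun applicable ::
  "chase_variant \<Rightarrow> tgd set \<Rightarrow> trigger set \<Rightarrow> inst \<Rightarrow> trigger \<Rightarrow> bool" where
  "applicable Std \<Sigma> F I \<tau> \<longleftrightarrow> is_trigger \<Sigma> I \<tau> \<and> active I \<tau>"
| "applicable Obl \<Sigma> F I \<tau> \<longleftrightarrow> is_trigger \<Sigma> I \<tau> \<and> \<tau> \<notin> F"
| "applicable Sobl \<Sigma> F I \<tau> \<longleftrightarrow> is_trigger \<Sigma> I \<tau> \<and> \<not> (\<exists>\<sigma>\<in>F. equivalent_triggers \<tau> \<sigma>)"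

text \<open>
  A finite or infinite sequence is given by its number \<open>n\<close> of steps, the instances \<open>Is i\<close> for
  \<open>i \<le> n\<close>, and the triggers \<open>ts i\<close> for \<open>i < n\<close>, where \<open>ts i\<close> is fired in the step from \<open>Is i\<close> to
  \<open>Is (Suc i)\<close>. The values of \<open>Is\<close> and \<open>ts\<close> beyond these ranges are irrelevant.
\<close>

definition applicable_at ::
  "chase_variant \<Rightarrow> tgd set \<Rightarrow> (nat \<Rightarrow> inst) \<Rightarrow> (nat \<Rightarrow> trigger) \<Rightarrow> nat \<Rightarrow> trigger \<Rightarrow> bool" where
  "applicable_at v \<Sigma> Is ts i \<tau> \<longleftrightarrow> applicable v \<Sigma> (ts ` {..<i}) (Is i) \<tau>"

definition chase_steps ::
  "chase_variant \<Rightarrow> tgd set \<Rightarrow> inst \<Rightarrow> enat \<Rightarrow> (nat \<Rightarrow> inst) \<Rightarrow> (nat \<Rightarrow> trigger) \<Rightarrow> bool" where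
  "chase_steps v \<Sigma> I n Is ts \<longleftrightarrow>
     Is 0 = I \<and>
     (\<forall>i. enat i < n \<longrightarrow> applicable_at v \<Sigma> Is ts i (ts i) \<and> fires (ts i) (Is i) (Is (Suc i)))"

definition fair ::
  "chase_variant \<Rightarrow> tgd set \<Rightarrow> enat \<Rightarrow> (nat \<Rightarrow> inst) \<Rightarrow> (nat \<Rightarrow> trigger) \<Rightarrow> bool" where
  "fair v \<Sigma> n Is ts \<longleftrightarrow>
     (n = \<infinity> \<longrightarrow>
       (\<forall>i \<tau>. applicable_at v \<Sigma> Is ts i \<tau> \<longrightarrow>
         (\<exists>j\<ge>i. ts j = \<tau> \<or> \<not> applicable_at v \<Sigma> Is ts j \<tau>)))"

text \<open>
  A finite sequence that stops although a trigger is still applicable is only a prefix of a chase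
  sequence. Such prefixes are excluded: otherwise the trivial sequence of length zero would be a
  non-terminating chase sequence as soon as some trigger is applicable on the initial instance.
\<close>

definition maximal ::
  "chase_variant \<Rightarrow> tgd set \<Rightarrow> enat \<Rightarrow> (nat \<Rightarrow> inst) \<Rightarrow> (nat \<Rightarrow> trigger) \<Rightarrow> bool" where
  "maximal v \<Sigma> n Is ts \<longleftrightarrow> (\<forall>m. n = enat m \<longrightarrow> \<not> (\<exists>\<tau>. applicable_at v \<Sigma> Is ts m \<tau>))"

definition chase_sequence ::
  "chase_variant \<Rightarrow> tgd set \<Rightarrow> inst \<Rightarrow> enat \<Rightarrow> (nat \<Rightarrow> inst) \<Rightarrow> (nat \<Rightarrow> trigger) \<Rightarrow> bool" where
  "chase_sequence v \<Sigma> I n Is ts \<longleftrightarrow>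
     chase_steps v \<Sigma> I n Is ts \<and> maximal v \<Sigma> n Is ts \<and> fair v \<Sigma> n Is ts"

definition terminates ::
  "chase_variant \<Rightarrow> tgd set \<Rightarrow> enat \<Rightarrow> (nat \<Rightarrow> inst) \<Rightarrow> (nat \<Rightarrow> trigger) \<Rightarrow> bool" where
  "terminates v \<Sigma> n Is ts \<longleftrightarrow>
     (\<exists>i. enat i \<le> n \<and> \<not> (\<exists>\<tau>. applicable_at v \<Sigma> Is ts i \<tau>))"


section \<open>Termination classes\<close>

definition CT_all_all :: "chase_variant \<Rightarrow> tgd set set" where
  "CT_all_all v = {\<Sigma>. (\<exists>S. schema S \<and> tgds_over S \<Sigma>) \<and>
     (\<forall>S I. schema S \<and> tgds_over S \<Sigma> \<and> instance_over S I \<longrightarrow>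
       (\<forall>n Is ts. chase_sequence v \<Sigma> I n Is ts \<longrightarrow> terminates v \<Sigma> n Is ts))}"

definition CT_all_ex :: "chase_variant \<Rightarrow> tgd set set" where
  "CT_all_ex v = {\<Sigma>. (\<exists>S. schema S \<and> tgds_over S \<Sigma>) \<and>
     (\<forall>S I. schema S \<and> tgds_over S \<Sigma> \<and> instance_over S I \<longrightarrow>
       (\<exists>n Is ts. chase_sequence v \<Sigma> I n Is ts \<and> terminates v \<Sigma> n Is ts))}"

end

(*
  All inclusions between different chase variants come from one comparison. Let B be a finite
  (semi-)oblivious run that has fired every trigger up to equivalence, and A any run on the same
  instance that never fires two equivalent triggers. Then A embeds into the last instance of B:
  each trigger of A is mapped to a trigger fired by B, and fresh nulls to the corresponding fresh
  nulls. The embedding stays injective because inequivalent triggers have inequivalent images, so A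
  has at most as many steps as B. Oblivious and semi-oblivious runs never repeat a trigger, and
  neither does a standard run, as firing a trigger deactivates all equivalent ones.

  Properness is witnessed by P(x) -> EX z. P(z), by P(x) -> EX z. P(x) & P(z), and by the pair
  E(x,y) -> EX z. E(y,z) and E(x,y) -> E(y,y).
*)
theory Submission
  imports Defs "HOL-Library.Countable_Set"
begin

section \<open>Values, assignments and firing\<close>

text \<open>Every constant counts, even one not occurring in \<open>I\<close>: heads may introduce
  constants, so firing a trigger enlarges \<open>vals\<close> by the fresh nulls only, and a map
  that fixes constants and is injective on \<open>vals I\<close> sends no null of \<open>I\<close>
  to a constant.\<close>

definition vals :: "inst \<Rightarrow> val set" where
  "vals I = range Const \<union> Null ` nulls I"

lemma set_atom_eq: "set_atom A = set (args A)"
  by (cases A) simp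

lemma args_map_atom [simp]: "args (map_atom f A) = map f (args A)"
  by (cases A) simp

lemma vals_mono: "I \<subseteq> J \<Longrightarrow> vals I \<subseteq> vals J"
  by (auto simp: vals_def nulls_def)

lemma nulls_mono: "I \<subseteq> J \<Longrightarrow> nulls I \<subseteq> nulls J"
  by (auto simp: nulls_def)

lemma args_in_vals: "A \<in> I \<Longrightarrow> v \<in> set (args A) \<Longrightarrow> v \<in> vals I"
  by (cases v) (auto simp: vals_def nulls_def)

lemma finite_nulls:
  assumes "finite I"
  shows "finite (nulls I)"
proof -
  have "Null ` nulls I \<subseteq> (\<Union>A\<in>I. set (args A))"
    by (auto simp: nulls_def)
  then have "finite (Null ` nulls I)"
    by (rule finite_subset) (use assms in auto)
  then show ?thesis
    by (rule finite_imageD) (simp add: inj_on_def)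
qed

lemma finite_vars: "finite (vars As)"
proof -
  have "Var ` vars As \<subseteq> (\<Union>A\<in>set As. set (args A))"
    by (auto simp: vars_def)
  then have "finite (Var ` vars As)"
    by (rule finite_subset) auto
  then show ?thesis
    by (rule finite_imageD) (simp add: inj_on_def)
qed

lemma value_in_image_atoms:
  assumes "x \<in> vars As"
  shows "\<exists>A\<in>image_atoms h As. the (h x) \<in> set (args A)"
proof -
  from assms obtain A where "A \<in> set As" "Var x \<in> set (args A)"
    by (auto simp: vars_def)
  then show ?thesis
    by (intro bexI[of _ "map_atom (eval_trm h) A"]) (auto simp: image_atoms_def intro!: rev_image_eqI)
qed

lemma nulls_image_atomsI:
  "x \<in> vars As \<Longrightarrow> the (h x) = Null n \<Longrightarrow> n \<in> nulls (image_atoms h As)"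
  using value_in_image_atoms[of x As h] by (auto simp: nulls_def)

lemma nulls_image_atomsD:
  assumes "n \<in> nulls (image_atoms h As)"
  shows "\<exists>x\<in>vars As. the (h x) = Null n"
proof -
  from assms obtain A t where A: "A \<in> set As" "t \<in> set (args A)" "eval_trm h t = Null n"
    by (auto simp: nulls_def image_atoms_def)
  show ?thesis
    by (cases t) (use A in \<open>auto simp: vars_def\<close>)
qed

lemma map_image_atoms:
  assumes "\<And>c. f (Const c) = Const c"
    and "\<And>x. x \<in> vars As \<Longrightarrow> f (the (h x)) = the (g x)"
  shows "map_atom f ` image_atoms h As = image_atoms g As"
proof -
  have "map_atom f (map_atom (eval_trm h) A) = map_atom (eval_trm g) A" if "A \<in> set As" for A
  proof -
    have "f (eval_trm h t) = eval_trm g t" if "t \<in> set (args A)" for t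
      by (cases t) (use that \<open>A \<in> set As\<close> assms in \<open>auto simp: vars_def\<close>)
    then show ?thesis
      by (cases A) auto
  qed
  then show ?thesis
    by (auto simp: image_atoms_def image_image)
qed

lemma finite_image_atoms: "finite (image_atoms h As)"
  by (simp add: image_atoms_def)

lemma trigger_values:
  assumes "is_trigger \<Sigma> I \<tau>"
  shows "ran (snd \<tau>) \<subseteq> vals I"
proof
  fix v assume "v \<in> ran (snd \<tau>)"
  then obtain x where x: "snd \<tau> x = Some v"
    by (auto simp: ran_def)
  then have "x \<in> vars (body (fst \<tau>))"
    using assms by (auto simp: is_trigger_def universal_vars_def split: prod.splits)
  from value_in_image_atoms[OF this, of "snd \<tau>"] x assms
  show "v \<in> vals I"
    by (auto simp: is_trigger_def split: prod.splits intro: args_in_vals)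
qed

lemma fires_mono: "fires \<tau> I J \<Longrightarrow> I \<subseteq> J"
  by (auto simp: fires_def split: prod.splits)

lemma fires_finite: "fires \<tau> I J \<Longrightarrow> finite I \<Longrightarrow> finite J"
  by (auto simp: fires_def finite_image_atoms split: prod.splits)

lemma fires_not_active:
  assumes "fires \<tau> I J" "J \<subseteq> K"
  shows "\<not> active K \<tau>"
  using assms by (auto simp: fires_def active_def split: prod.splits)

lemma fires_exists:
  assumes "finite I" and "is_trigger \<Sigma> I \<tau>"
  shows "\<exists>J. fires \<tau> I J"
proof -
  obtain \<xi> h where \<tau>: "\<tau> = (\<xi>, h)" by (cases \<tau>)
  have dom: "dom h = universal_vars \<xi>"
    using assms(2) by (simp add: \<tau> is_trigger_def)
  have "finite (existential_vars \<xi>)"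
    by (simp add: existential_vars_def finite_vars)
  moreover have "infinite (- nulls I)"
    using finite_nulls[OF assms(1)] by (simp add: finite_compl)
  ultimately obtain N where N: "finite N" "card N = card (existential_vars \<xi>)" "N \<subseteq> - nulls I"
    using infinite_arbitrarily_large by blast
  then obtain e where "bij_betw e (existential_vars \<xi>) N"
    using \<open>finite (existential_vars \<xi>)\<close> finite_same_card_bij by metis
  then have e: "inj_on e (existential_vars \<xi>)" "e ` existential_vars \<xi> \<subseteq> - nulls I"
    using N(3) by (auto simp: bij_betw_def)
  define h' where "h' = (\<lambda>x. if x \<in> existential_vars \<xi> then Some (Null (e x)) else h x)"
  have disj: "existential_vars \<xi> \<inter> universal_vars \<xi> = {}"
    by (auto simp: existential_vars_def universal_vars_def)
  have "extension \<xi> h h'"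
    using dom disj by (auto simp: extension_def h'_def map_le_def dom_def)
  moreover have "inj_on h' (existential_vars \<xi>)"
    using e(1) by (auto simp: h'_def inj_on_def)
  moreover have "\<forall>z\<in>existential_vars \<xi>. \<exists>n. h' z = Some (Null n) \<and> n \<notin> nulls I"
    using e(2) by (auto simp: h'_def)
  ultimately show ?thesis
    by (auto simp: \<tau> fires_def)
qed


section \<open>Comparing runs\<close>

definition map_trigger :: "(val \<Rightarrow> val) \<Rightarrow> trigger \<Rightarrow> trigger" where
  "map_trigger f \<tau> = (fst \<tau>, map_option f \<circ> snd \<tau>)"

lemma map_trigger_cong:
  "(\<And>v. v \<in> ran (snd \<tau>) \<Longrightarrow> f v = g v) \<Longrightarrow> map_trigger f \<tau> = map_trigger g \<tau>"
  by (auto simp: map_trigger_def fun_eq_iff ran_def intro!: option.map_cong)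

text \<open>Bodies are conjunctions of atoms, so a homomorphism that fixes the constants carries a
  match of the body to a match.\<close>

lemma is_trigger_map:
  assumes "is_trigger \<Sigma> I \<tau>" "\<And>c. f (Const c) = Const c" "map_atom f ` I \<subseteq> J"
  shows "is_trigger \<Sigma> J (map_trigger f \<tau>)"
proof -
  obtain \<xi> h where \<tau>: "\<tau> = (\<xi>, h)" by (cases \<tau>)
  have dom: "dom h = vars (body \<xi>)" and im: "image_atoms h (body \<xi>) \<subseteq> I" and "\<xi> \<in> \<Sigma>"
    using assms(1) by (auto simp: \<tau> is_trigger_def universal_vars_def)
  have "map_atom f ` image_atoms h (body \<xi>) = image_atoms (map_option f \<circ> h) (body \<xi>)"
    by (rule map_image_atoms) (use assms(2) dom in force)+
  then have "image_atoms (map_option f \<circ> h) (body \<xi>) \<subseteq> J"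
    using im assms(3) by blast
  then show ?thesis
    using dom \<open>\<xi> \<in> \<Sigma>\<close> by (auto simp: \<tau> map_trigger_def is_trigger_def universal_vars_def dom_def)
qed

lemma map_option_inj_on:
  assumes "inj_on f V" "set_option a \<subseteq> V" "set_option b \<subseteq> V" "map_option f a = map_option f b"
  shows "a = b"
  using assms by (cases a; cases b) (auto dest: inj_onD)

text \<open>Covers both notions of "same trigger": equality for the oblivious chase and agreement on
  the frontier for the semi-oblivious one. \<open>equivalent\<close> makes related triggers demand
  the same head up to existential values; \<open>reflect\<close> says that an injective renaming
  never merges unrelated triggers, on which the counting of steps rests.\<close>

locale trigger_equivalence =
  fixes R :: "trigger \<Rightarrow> trigger \<Rightarrow> bool"
  assumes equivp: "equivp R"
    and equivalent: "R \<tau> \<sigma> \<Longrightarrow> equivalent_triggers \<tau> \<sigma>"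
    and reflect: "R (map_trigger f \<tau>) (map_trigger f \<sigma>) \<Longrightarrow> inj_on f V \<Longrightarrow>
      ran (snd \<tau>) \<subseteq> V \<Longrightarrow> ran (snd \<sigma>) \<subseteq> V \<Longrightarrow> R \<tau> \<sigma>"

interpretation identity: trigger_equivalence "(=)"
proof
  fix f \<tau> \<sigma> V
  assume eq: "map_trigger f \<tau> = map_trigger f \<sigma>" and inj: "inj_on f V"
    and V: "ran (snd \<tau>) \<subseteq> V" "ran (snd \<sigma>) \<subseteq> V"
  have "snd \<tau> x = snd \<sigma> x" for x
    by (rule map_option_inj_on[OF inj])
      (use V eq in \<open>auto simp: map_trigger_def fun_eq_iff ran_def elem_set\<close>)
  then show "\<tau> = \<sigma>"
    using eq by (auto simp: map_trigger_def prod_eq_iff)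
qed (auto simp: identity_equivp equivalent_triggers_def)

interpretation frontier: trigger_equivalence equivalent_triggers
proof
  show "equivp equivalent_triggers"
    by (rule equivpI) (auto simp: reflp_def symp_def transp_def equivalent_triggers_def)
next
  fix f \<tau> \<sigma> V
  assume eq: "equivalent_triggers (map_trigger f \<tau>) (map_trigger f \<sigma>)" and inj: "inj_on f V"
    and V: "ran (snd \<tau>) \<subseteq> V" "ran (snd \<sigma>) \<subseteq> V"
  have "snd \<tau> x = snd \<sigma> x" if "x \<in> frontier_vars (fst \<tau>)" for x
    by (rule map_option_inj_on[OF inj])
      (use V eq that in \<open>auto simp: map_trigger_def equivalent_triggers_def ran_def elem_set\<close>)
  then show "equivalent_triggers \<tau> \<sigma>"
    using eq by (auto simp: map_trigger_def equivalent_triggers_def)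
qed

text \<open>The common shape of all three chases: the test for applicability is replaced by a ban on
  triggers related to earlier ones, so that sequences of different variants become
  comparable.\<close>

definition run ::
  "(trigger \<Rightarrow> trigger \<Rightarrow> bool) \<Rightarrow> tgd set \<Rightarrow> inst \<Rightarrow> enat \<Rightarrow> (nat \<Rightarrow> inst) \<Rightarrow> (nat \<Rightarrow> trigger) \<Rightarrow> bool" where
  "run R \<Sigma> I n Is ts \<longleftrightarrow> Is 0 = I \<and>
     (\<forall>i. enat i < n \<longrightarrow> is_trigger \<Sigma> (Is i) (ts i) \<and> fires (ts i) (Is i) (Is (Suc i)) \<and>
        (\<forall>j<i. \<not> R (ts i) (ts j)))"

lemma steps_mono:
  assumes "\<And>i. enat i < n \<Longrightarrow> fires (ts i) (Is i) (Is (Suc i))" "enat j \<le> n" "i \<le> j"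
  shows "Is i \<subseteq> Is j"
  using assms(3,2)
proof (induction j rule: dec_induct)
  case (step j)
  then have "enat j < n"
    by (metis Suc_ile_eq)
  then show ?case
    using step.IH fires_mono[OF assms(1)] by (blast dest: less_imp_le)
qed simp

lemma run_mono: "run R \<Sigma> I n Is ts \<Longrightarrow> enat j \<le> n \<Longrightarrow> i \<le> j \<Longrightarrow> Is i \<subseteq> Is j"
  by (rule steps_mono[of n ts]) (auto simp: run_def)

section \<open>Embedding a run into a saturated finite run\<close>

context trigger_equivalence
begin

context
  fixes \<Sigma> I n A t m B s
  assumes runA: "run R \<Sigma> I n A t"
    and runB: "run R \<Sigma> I (enat m) B s"
    and complete: "\<And>\<tau>. is_trigger \<Sigma> (B m) \<tau> \<Longrightarrow> \<exists>k<m. R \<tau> (s k)"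
begin

text \<open>Induction along \<open>A\<close>: the nulls invented in step \<open>i\<close> are sent
  to those invented by \<open>B\<close> in the step \<open>\<rho> i\<close>, whose trigger is
  related to the image of \<open>t i\<close>. The extensions \<open>g\<close> used by
  \<open>B\<close> are fixed in advance because the clause on new nulls refers to them: it records
  in which step of \<open>B\<close> the image of a new null was invented, which is what keeps later
  images apart from earlier ones.\<close>

lemma embedding_exists:
  assumes g: "\<And>k. k < m \<Longrightarrow> extension (fst (s k)) (snd (s k)) (g k)"
      "\<And>k. k < m \<Longrightarrow> inj_on (g k) (existential_vars (fst (s k)))"
      "\<And>k z. k < m \<Longrightarrow> z \<in> existential_vars (fst (s k)) \<Longrightarrow>
         \<exists>c. g k z = Some (Null c) \<and> c \<notin> nulls (B k)"
      "\<And>k. k < m \<Longrightarrow> B (Suc k) = B k \<union> image_atoms (g k) (head (fst (s k)))"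
    and "enat i \<le> n"
  shows "\<exists>f \<rho>. (\<forall>c. f (Const c) = Const c) \<and> (\<forall>c\<in>nulls I. f (Null c) = Null c) \<and>
     inj_on f (vals (A i)) \<and> map_atom f ` A i \<subseteq> B m \<and>
     (\<forall>j<i. \<rho> j < m \<and> R (map_trigger f (t j)) (s (\<rho> j))) \<and>
     (\<forall>c\<in>nulls (A i) - nulls I.
        \<exists>j<i. \<exists>z\<in>existential_vars (fst (s (\<rho> j))). f (Null c) = the (g (\<rho> j) z)) \<and>
     inj_on \<rho> {..<i}" (is "\<exists>f \<rho>. ?P i f \<rho>")
  using assms(5)
proof (induction i)
  case 0
  have "map_atom (\<lambda>v. v) ` A 0 \<subseteq> B m"
    using run_mono[OF runB, of m 0] runA runB by (auto simp: run_def atom.map_ident)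
  then show ?case
    using runA by (intro exI[of _ "\<lambda>v. v"]) (auto simp: run_def)
next
  case (Suc i)
  have i: "enat i < n"
    using Suc.prems by (simp add: Suc_ile_eq)
  then obtain f \<rho> where IH: "?P i f \<rho>"
    using Suc.IH[OF less_imp_le] by blast
  then have fC: "\<And>c. f (Const c) = Const c"
    and fI: "\<And>c. c \<in> nulls I \<Longrightarrow> f (Null c) = Null c"
    and finj: "inj_on f (vals (A i))" and fim: "map_atom f ` A i \<subseteq> B m"
    and \<rho>: "\<And>j. j < i \<Longrightarrow> \<rho> j < m" "\<And>j. j < i \<Longrightarrow> R (map_trigger f (t j)) (s (\<rho> j))"
    and fN: "\<And>c. c \<in> nulls (A i) - nulls I \<Longrightarrow>
        \<exists>j<i. \<exists>z\<in>existential_vars (fst (s (\<rho> j))). f (Null c) = the (g (\<rho> j) z)"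
    and \<rho>inj: "inj_on \<rho> {..<i}"
    by blast+
  obtain \<xi> h where ti: "t i = (\<xi>, h)" by (cases "t i")
  have trig: "is_trigger \<Sigma> (A i) (t i)" and fire: "fires (t i) (A i) (A (Suc i))"
    and new: "\<And>j. j < i \<Longrightarrow> \<not> R (t i) (t j)"
    using runA i by (auto simp: run_def)
  \<comment> \<open>The image of \<open>t i\<close> is a trigger on the last instance of
    \<open>B\<close>, where every trigger is related to a fired one.\<close>
  obtain k where k: "k < m" "R (map_trigger f (t i)) (s k)"
    using complete is_trigger_map[OF trig fC fim] by blast
  have eq: "fst (s k) = \<xi>" "\<And>x. x \<in> frontier_vars \<xi> \<Longrightarrow> map_option f (h x) = snd (s k) x"
    using equivalent[OF k(2)] by (auto simp: equivalent_triggers_def ti map_trigger_def)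
  have ran_vals: "ran (snd (t j)) \<subseteq> vals (A i)" if "j \<le> i" for j
  proof -
    have "enat j < n" using that i by (meson enat_ord_simps(1) le_less_trans)
    then have "ran (snd (t j)) \<subseteq> vals (A j)"
      using runA trigger_values unfolding run_def by blast
    then show ?thesis
      using vals_mono[OF run_mono[OF runA less_imp_le[OF i] that]] by blast
  qed
  \<comment> \<open>Using step \<open>k\<close> twice would relate the images of \<open>t i\<close>
    and \<open>t j\<close>; as \<open>f\<close> is injective on their values, the triggers
    themselves would be related, which a run forbids.\<close>
  have knew: "\<rho> j \<noteq> k" if "j < i" for j
  proof
    assume "\<rho> j = k"
    then have "R (map_trigger f (t i)) (map_trigger f (t j))"
      using k(2) \<rho>(2)[OF that] equivp by (meson equivp_symp equivp_transp)
    then have "R (t i) (t j)"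
      by (rule reflect[OF _ finj ran_vals ran_vals]) (use that in auto)
    then show False
      using new that by blast
  qed
  obtain h' where h': "extension \<xi> h h'" "inj_on h' (existential_vars \<xi>)"
    "\<And>z. z \<in> existential_vars \<xi> \<Longrightarrow> \<exists>c. h' z = Some (Null c) \<and> c \<notin> nulls (A i)"
    and ASuc: "A (Suc i) = A i \<union> image_atoms h' (head \<xi>)"
    using fire by (auto simp: fires_def ti)
  have domh: "dom h = vars (body \<xi>)"
    using trig by (auto simp: ti is_trigger_def universal_vars_def)
  have h'h: "h' x = h x" if "x \<in> vars (body \<xi>)" for x
    using h'(1) domh that by (auto simp: extension_def map_le_def)
  define E where "E = existential_vars \<xi>"
  \<comment> \<open>A null that \<open>A\<close> invents for \<open>z\<close> goes to the null that
    \<open>B\<close> invents for \<open>z\<close> in step \<open>k\<close>. The variable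
    \<open>z\<close> is recovered from the null because \<open>h'\<close> is injective on
    \<open>E\<close>.\<close>
  define f' where "f' v = (if \<exists>z\<in>E. h' z = Some v
    then the (g k (inv_into E h' (Some v))) else f v)" for v
  have f'_new: "f' (the (h' z)) = the (g k z)" if z: "z \<in> E" for z
  proof -
    obtain c where "h' z = Some (Null c)" using h'(3)[of z] z by (auto simp: E_def)
    moreover have "inv_into E h' (h' z) = z"
      using h'(2) that E_def by simp
    ultimately show ?thesis
      using that by (auto simp: f'_def)
  qed
  have f'_old: "f' v = f v" if "v \<in> vals (A i)" for v
    using h'(3) that by (fastforce simp: f'_def vals_def E_def)
  have gk: "\<exists>c. g k z = Some (Null c) \<and> c \<notin> nulls (B k)" if "z \<in> E" for z
    using g(3)[OF k(1)] that eq E_def by auto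
  have Bmono: "nulls (B p) \<subseteq> nulls (B q)" if "p \<le> q" "q \<le> m" for p q
    using run_mono[OF runB, of q p] that by (intro nulls_mono) auto
  have gB: "c \<in> nulls (B (Suc q))"
    if "q < m" "z \<in> existential_vars (fst (s q))" "g q z = Some (Null c)" for q z c
    using that nulls_image_atomsI[of z "head (fst (s q))" "g q" c] g(4)[OF that(1)]
    by (auto simp: nulls_def existential_vars_def)
  \<comment> \<open>A null invented in step \<open>k\<close> of \<open>B\<close> is not the image of
    an old value. Nulls of \<open>I\<close> already occur in \<open>B k\<close>. Any other old null
    has its image invented in a step \<open>\<rho> j\<close> different from \<open>k\<close>, and
    whichever of the two steps comes later had to avoid the null of the earlier one.\<close>
  have disjoint: "the (g k z) \<noteq> f v" if z: "z \<in> E" and v: "v \<in> vals (A i)" for z v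
  proof
    assume fv: "the (g k z) = f v"
    obtain c where c: "g k z = Some (Null c)" "c \<notin> nulls (B k)"
      using gk z by blast
    obtain d where d: "v = Null d" "d \<in> nulls (A i)"
      using v fv c fC by (auto simp: vals_def)
    show False
    proof (cases "d \<in> nulls I")
      case True
      then show ?thesis
        using fI[of d] fv c d Bmono[of 0 k] k(1) runB by (auto simp: run_def)
    next
      case False
      then obtain j z' where j: "j < i" "z' \<in> existential_vars (fst (s (\<rho> j)))"
        "f (Null d) = the (g (\<rho> j) z')"
        using fN d by blast
      obtain c' where c': "g (\<rho> j) z' = Some (Null c')" "c' \<notin> nulls (B (\<rho> j))"
        using g(3)[OF \<rho>(1)] j by blast
      have "c = c'" using fv d j c c' by simp
      have "\<rho> j < k \<or> k < \<rho> j" using knew[OF j(1)] by auto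
      then show ?thesis
      proof
        assume "\<rho> j < k"
        then show False
          using gB[OF \<rho>(1)[OF j(1)] j(2) c'(1)] Bmono[of "Suc (\<rho> j)" k] k(1) c \<open>c = c'\<close> by auto
      next
        assume "k < \<rho> j"
        then show False
          using gB[OF k(1) _ c(1)] Bmono[of "Suc k" "\<rho> j"] \<rho>(1)[OF j(1)] c' \<open>c = c'\<close> z eq E_def
          by auto
      qed
    qed
  qed
  have nullsSuc: "c \<in> nulls (A i) \<or> (\<exists>z\<in>E. h' z = Some (Null c))" if "c \<in> nulls (A (Suc i))" for c
  proof (cases "c \<in> nulls (A i)")
    case False
    then have "c \<in> nulls (image_atoms h' (head \<xi>))"
      using that by (auto simp: ASuc nulls_def)
    then obtain x where x: "x \<in> vars (head \<xi>)" "the (h' x) = Null c"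
      using nulls_image_atomsD by blast
    have "x \<notin> vars (body \<xi>)"
    proof
      assume xb: "x \<in> vars (body \<xi>)"
      then have "Null c \<in> ran h"
        using x h'h domh by (force simp: ran_def dom_def)
      then show False
        using ran_vals[of i] False by (auto simp: ti vals_def)
    qed
    then have "x \<in> E" using x by (auto simp: E_def existential_vars_def)
    then show ?thesis using h'(3)[of x] x by (auto simp: E_def)
  qed simp
  have valsSuc: "v \<in> vals (A i) \<or> (\<exists>z\<in>E. h' z = Some v)" if "v \<in> vals (A (Suc i))" for v
    using nullsSuc that by (auto simp: vals_def)
  have "inj_on f' (vals (A (Suc i)))"
  proof (rule inj_onI)
    fix u v assume u: "u \<in> vals (A (Suc i))" and v: "v \<in> vals (A (Suc i))" and "f' u = f' v"
    consider "u \<in> vals (A i)" "v \<in> vals (A i)"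
      | z where "z \<in> E" "h' z = Some u" "v \<in> vals (A i)"
      | z where "z \<in> E" "h' z = Some v" "u \<in> vals (A i)"
      | z z' where "z \<in> E" "h' z = Some u" "z' \<in> E" "h' z' = Some v"
      using valsSuc[OF u] valsSuc[OF v] by blast
    then show "u = v"
    proof cases
      case 1
      then show ?thesis using f'_old \<open>f' u = f' v\<close> finj by (auto dest: inj_onD)
    next
      case 2
      then show ?thesis using f'_old f'_new[of z] \<open>f' u = f' v\<close> disjoint by (metis option.sel)
    next
      case 3
      then show ?thesis using f'_old f'_new[of z] \<open>f' u = f' v\<close> disjoint by (metis option.sel)
    next
      case 4
      then have "the (g k z) = the (g k z')"
        using f'_new[of z] f'_new[of z'] \<open>f' u = f' v\<close> by auto
      then have "g k z = g k z'"
        using gk[OF 4(1)] gk[OF 4(3)] by auto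
      then have "z = z'"
        using g(2)[OF k(1)] 4 eq E_def by (auto dest: inj_onD)
      then show ?thesis using 4 by simp
    qed
  qed
  moreover have f'C: "f' (Const c) = Const c" for c
    using f'_old[of "Const c"] fC by (simp add: vals_def)
  moreover have "f' (Null c) = Null c" if "c \<in> nulls I" for c
  proof -
    have "c \<in> nulls (A i)"
      using that nulls_mono[OF run_mono[OF runA less_imp_le[OF i], of 0]] runA by (auto simp: run_def)
    then show ?thesis using f'_old fI that by (auto simp: vals_def)
  qed
  moreover have "map_atom f' ` A (Suc i) \<subseteq> B m"
  proof -
    have "map_atom f' a = map_atom f a" if "a \<in> A i" for a
      using that args_in_vals f'_old by (intro atom.map_cong) (auto simp: set_atom_eq)
    then have "map_atom f' ` A i \<subseteq> B m" using fim by auto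
    \<comment> \<open>A head variable is either on the frontier, where \<open>s k\<close> agrees
      with the image of \<open>t i\<close>, or existential, where \<open>f'\<close> was chosen to
      match \<open>g k\<close>.\<close>
    moreover have "map_atom f' ` image_atoms h' (head \<xi>) = image_atoms (g k) (head \<xi>)"
    proof (rule map_image_atoms[OF f'C])
      fix x assume x: "x \<in> vars (head \<xi>)"
      show "f' (the (h' x)) = the (g k x)"
      proof (cases "x \<in> vars (body \<xi>)")
        case True
        then have fr: "x \<in> frontier_vars \<xi>" using x by (auto simp: frontier_vars_def)
        obtain u where u: "h x = Some u" using True domh by blast
        then have "u \<in> vals (A i)" using ran_vals[of i] by (auto simp: ti ran_def)
        then have "f' (the (h' x)) = f u" using f'_old h'h[OF True] u by simp
        moreover have "snd (s k) x = Some (f u)" using eq(2)[OF fr] u by simp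
        moreover have "g k x = snd (s k) x"
          using g(1)[OF k(1)] calculation(2) by (auto simp: extension_def map_le_def dom_def)
        ultimately show ?thesis by simp
      next
        case False
        then show ?thesis using f'_new[of x] x by (simp add: E_def existential_vars_def)
      qed
    qed
    moreover have "image_atoms (g k) (head \<xi>) \<subseteq> B m"
      using g(4)[OF k(1)] eq run_mono[OF runB, of m "Suc k"] k(1) by auto
    ultimately show ?thesis by (simp add: ASuc image_Un)
  qed
  moreover have "\<forall>j<Suc i. (\<rho>(i := k)) j < m \<and> R (map_trigger f' (t j)) (s ((\<rho>(i := k)) j))"
  proof (intro allI impI)
    fix j assume j: "j < Suc i"
    have "map_trigger f' (t j) = map_trigger f (t j)"
      by (rule map_trigger_cong) (use ran_vals[of j] j f'_old in auto)
    then show "(\<rho>(i := k)) j < m \<and> R (map_trigger f' (t j)) (s ((\<rho>(i := k)) j))"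
      using k \<rho> j by (auto simp: less_Suc_eq)
  qed
  moreover have "\<exists>j<Suc i. \<exists>z\<in>existential_vars (fst (s ((\<rho>(i := k)) j))).
      f' (Null c) = the (g ((\<rho>(i := k)) j) z)" if c: "c \<in> nulls (A (Suc i)) - nulls I" for c
  proof (cases "c \<in> nulls (A i)")
    case True
    then obtain j z where "j < i" "z \<in> existential_vars (fst (s (\<rho> j)))" "f (Null c) = the (g (\<rho> j) z)"
      using fN c by blast
    then show ?thesis using f'_old[of "Null c"] True
      by (intro exI[of _ j]) (auto simp: vals_def)
  next
    case False
    then obtain z where "z \<in> E" "h' z = Some (Null c)" using nullsSuc c by blast
    then show ?thesis using f'_new[of z] eq
      by (intro exI[of _ i]) (auto simp: E_def)
  qed
  moreover have "inj_on (\<rho>(i := k)) {..<Suc i}"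
    using \<rho>inj knew by (force simp: inj_on_def less_Suc_eq)
  ultimately show ?case
    by (intro exI[of _ f'] exI[of _ "\<rho>(i := k)"]) blast
qed

text \<open>The map \<open>\<rho>\<close> of the embedding injects the first \<open>i\<close> steps
  of \<open>A\<close> into the \<open>m\<close> steps of \<open>B\<close>.\<close>

lemma run_length_le:
  assumes "enat i \<le> n"
  shows "i \<le> m"
proof -
  have "\<forall>k. \<exists>g. k < m \<longrightarrow> extension (fst (s k)) (snd (s k)) g \<and>
      inj_on g (existential_vars (fst (s k))) \<and>
      (\<forall>z\<in>existential_vars (fst (s k)). \<exists>c. g z = Some (Null c) \<and> c \<notin> nulls (B k)) \<and>
      B (Suc k) = B k \<union> image_atoms g (head (fst (s k)))"
    using runB by (fastforce simp: run_def fires_def case_prod_beta)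
  then obtain g where
      g: "\<And>k. k < m \<Longrightarrow> extension (fst (s k)) (snd (s k)) (g k)"
        "\<And>k. k < m \<Longrightarrow> inj_on (g k) (existential_vars (fst (s k)))"
        "\<And>k z. k < m \<Longrightarrow> z \<in> existential_vars (fst (s k)) \<Longrightarrow>
           \<exists>c. g k z = Some (Null c) \<and> c \<notin> nulls (B k)"
        "\<And>k. k < m \<Longrightarrow> B (Suc k) = B k \<union> image_atoms (g k) (head (fst (s k)))"
    by metis
  have "\<exists>\<rho>. inj_on \<rho> {..<i} \<and> (\<forall>j<i. \<rho> j < m)"
    by (rule exE, rule embedding_exists[OF g assms], assumption+, elim exE conjE, blast)
  then obtain \<rho> where "inj_on \<rho> {..<i}" "\<forall>j<i. \<rho> j < m"
    by blast
  then show ?thesis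
    using card_inj_on_le[of \<rho> "{..<i}" "{..<m}"] by auto
qed

end

text \<open>A finite maximal sequence ends with no applicable trigger; an infinite one would have a
  prefix of \<open>Suc m\<close> steps, one more than the bound allows.\<close>

lemma terminates_if_complete_run:
  assumes "run R \<Sigma> I n Is ts" "maximal v \<Sigma> n Is ts"
    and "run R \<Sigma> I (enat m) B s" "\<And>\<tau>. is_trigger \<Sigma> (B m) \<tau> \<Longrightarrow> \<exists>k<m. R \<tau> (s k)"
  shows "terminates v \<Sigma> n Is ts"
proof (cases n)
  case (enat k)
  then show ?thesis
    using assms(2) by (auto simp: terminates_def maximal_def)
next
  case infinity
  then show ?thesis
    using run_length_le[OF assms(1,3,4), of "Suc m"] by simp
qed

text \<open>A terminating \<open>v\<close>-sequence, cut where nothing is applicable, serves as the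
  saturated run that bounds every \<open>w\<close>-sequence on the same instance. By
  \<open>stop_v\<close>, a trigger refused by \<open>v\<close> is related to a fired one. This
  restricts \<open>v\<close> to the oblivious variants, as an inactive trigger of the standard chase
  need have no such predecessor; \<open>w\<close> may be standard.\<close>

lemma CT_all_ex_subset_CT_all_all:
  assumes steps_v: "\<And>\<Sigma> I n Is ts. chase_steps v \<Sigma> I n Is ts \<Longrightarrow> run R \<Sigma> I n Is ts"
    and stop_v: "\<And>\<Sigma> F I \<tau>. \<not> applicable v \<Sigma> F I \<tau> \<Longrightarrow> is_trigger \<Sigma> I \<tau> \<Longrightarrow> \<exists>\<sigma>\<in>F. R \<tau> \<sigma>"
    and steps_w: "\<And>\<Sigma> I n Is ts. chase_steps w \<Sigma> I n Is ts \<Longrightarrow> run R \<Sigma> I n Is ts"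
  shows "CT_all_ex v \<subseteq> CT_all_all w"
proof
  fix \<Sigma> assume \<Sigma>: "\<Sigma> \<in> CT_all_ex v"
  have "terminates w \<Sigma> n Is ts"
    if S: "schema S" "tgds_over S \<Sigma>" "instance_over S I" and w: "chase_sequence w \<Sigma> I n Is ts"
    for S I n Is ts
  proof -
    obtain k B s m where B: "chase_steps v \<Sigma> I k B s" "enat m \<le> k"
      "\<And>\<tau>. \<not> applicable_at v \<Sigma> B s m \<tau>"
      using \<Sigma> S by (fastforce simp: CT_all_ex_def chase_sequence_def terminates_def)
    have "chase_steps v \<Sigma> I (enat m) B s"
      using B(1,2) unfolding chase_steps_def by (meson less_le_trans)
    moreover have "\<exists>k<m. R \<tau> (s k)" if "is_trigger \<Sigma> (B m) \<tau>" for \<tau>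
      using stop_v[OF _ that] B(3)[of \<tau>] by (auto simp: applicable_at_def)
    ultimately show ?thesis
      using w steps_v steps_w terminates_if_complete_run[of \<Sigma> I n Is ts w m B s]
      by (auto simp: chase_sequence_def)
  qed
  then show "\<Sigma> \<in> CT_all_all w"
    using \<Sigma> by (auto simp: CT_all_ex_def CT_all_all_def)
qed

end

text \<open>The atoms added by firing \<open>\<sigma>\<close> depend on its frontier values and its
  invented nulls only. Keeping the values of \<open>\<tau>\<close> on body variables and reusing
  those nulls for the existential ones therefore satisfies the head for
  \<open>\<tau>\<close>.\<close>

lemma equivalent_fired_not_active:
  assumes \<tau>: "is_trigger \<Sigma> K \<tau>" and eq: "equivalent_triggers \<tau> \<sigma>"
    and \<sigma>: "fires \<sigma> I J" "J \<subseteq> K"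
  shows "\<not> active K \<tau>"
proof -
  obtain \<xi> h h\<^sub>\<sigma> where \<tau>\<sigma>: "\<tau> = (\<xi>, h)" "\<sigma> = (\<xi>, h\<^sub>\<sigma>)"
    using eq by (metis equivalent_triggers_def prod.collapse)
  obtain g where g: "extension \<xi> h\<^sub>\<sigma> g" "image_atoms g (head \<xi>) \<subseteq> K"
      and exg: "\<forall>z\<in>existential_vars \<xi>. \<exists>n. g z = Some (Null n)"
    using \<sigma> by (fastforce simp: fires_def \<tau>\<sigma>)
  have dom: "dom h = vars (body \<xi>)"
    using \<tau> by (auto simp: \<tau>\<sigma> is_trigger_def universal_vars_def)
  define g' where "g' x = (if x \<in> vars (body \<xi>) then h x else g x)" for x
  have "extension \<xi> h g'"
    using g(1) dom
    by (auto simp: extension_def map_le_def g'_def dom_def universal_vars_def existential_vars_def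
        split: if_splits)
  moreover have "image_atoms g' (head \<xi>) \<subseteq> K"
  proof -
    have "g' x = g x" if "x \<in> vars (head \<xi>)" for x
    proof (cases "x \<in> vars (body \<xi>)")
      case True
      then have "h\<^sub>\<sigma> x = h x"
        using eq that by (auto simp: equivalent_triggers_def frontier_vars_def \<tau>\<sigma>)
      moreover have "x \<in> dom h" using True dom by simp
      ultimately show ?thesis
        using g(1) True by (auto simp: extension_def map_le_def g'_def dom_def)
    qed (simp add: g'_def)
    then have "image_atoms g' (head \<xi>) = image_atoms g (head \<xi>)"
      using map_image_atoms[of "\<lambda>v. v" "head \<xi>" g' g] by (simp add: atom.map_ident)
    then show ?thesis using g(2) by simp
  qed
  ultimately show ?thesis
    by (auto simp: active_def \<tau>\<sigma>)
qed

section \<open>The chase variants as runs\<close>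

lemma chase_steps_mono:
  "chase_steps v \<Sigma> I n Is ts \<Longrightarrow> enat j \<le> n \<Longrightarrow> i \<le> j \<Longrightarrow> Is i \<subseteq> Is j"
  by (rule steps_mono[of n ts]) (auto simp: chase_steps_def)

lemma run_Obl: "chase_steps Obl \<Sigma> I n Is ts \<Longrightarrow> run (=) \<Sigma> I n Is ts"
  by (auto simp: chase_steps_def applicable_at_def run_def)

lemma run_Sobl: "chase_steps Sobl \<Sigma> I n Is ts \<Longrightarrow> run equivalent_triggers \<Sigma> I n Is ts"
  by (auto simp: chase_steps_def applicable_at_def run_def)

lemma run_Std:
  assumes "chase_steps Std \<Sigma> I n Is ts"
  shows "run equivalent_triggers \<Sigma> I n Is ts"
proof -
  have "\<not> equivalent_triggers (ts i) (ts j)" if "enat i < n" "j < i" for i j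
  proof
    assume "equivalent_triggers (ts i) (ts j)"
    moreover have "enat j < n" using that by (meson enat_ord_simps(2) less_trans)
    moreover have "Is (Suc j) \<subseteq> Is i"
      using chase_steps_mono[OF assms, of i "Suc j"] that by auto
    ultimately have "\<not> active (Is i) (ts i)"
      using assms that equivalent_fired_not_active
      by (metis chase_steps_def applicable_at_def applicable.simps(1))
    then show False
      using assms that by (auto simp: chase_steps_def applicable_at_def)
  qed
  then show ?thesis
    using assms by (auto simp: chase_steps_def applicable_at_def run_def)
qed

text \<open>By reflexivity, avoiding equivalent triggers is the stronger demand. This lets
  semi-oblivious sequences be compared with oblivious ones.\<close>

lemma run_equivalent_imp_run: "run equivalent_triggers \<Sigma> I n Is ts \<Longrightarrow> run (=) \<Sigma> I n Is ts"
  unfolding run_def using equivp_reflp[OF frontier.equivp] by metis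

text \<open>With the same variant on both sides the comparison turns "some sequence" into "all
  sequences"; with two variants it gives an inclusion between their classes.\<close>

lemma CT_all_ex_Obl_subset:
  "CT_all_ex Obl \<subseteq> CT_all_all Obl" "CT_all_ex Obl \<subseteq> CT_all_all Sobl"
  by (rule identity.CT_all_ex_subset_CT_all_all;
      auto intro: run_Obl run_Sobl run_equivalent_imp_run)+

lemma CT_all_ex_Sobl_subset:
  "CT_all_ex Sobl \<subseteq> CT_all_all Sobl" "CT_all_ex Sobl \<subseteq> CT_all_all Std"
  by (rule frontier.CT_all_ex_subset_CT_all_all; auto intro: run_Sobl run_Std)+


section \<open>Existence of fair chase sequences\<close>

text \<open>The assignment of a trigger has finite domain, so its graph is a finite subset of a
  countable set. The resulting numbering of triggers drives the fair strategy below.\<close>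

lemma countable_triggers:
  assumes "finite \<Sigma>"
  shows "countable {\<tau> :: trigger. fst \<tau> \<in> \<Sigma> \<and> dom (snd \<tau>) = universal_vars (fst \<tau>)}"
proof -
  have "countable (UNIV :: val set)"
  proof (rule countable_subset)
    show "UNIV \<subseteq> range Const \<union> range Null"
      by (metis UnCI rangeI subsetI val.exhaust)
  qed simp
  then have "countable (UNIV \<times> UNIV :: (nat \<times> val) set)"
    by (intro countable_SIGMA) auto
  then have "countable {G :: (nat \<times> val) set. finite G \<and> G \<subseteq> UNIV \<times> UNIV}"
    by (rule countable_Collect_finite_subset)
  then have "countable (Map.graph ` {h :: assignment. finite (Map.graph h)})"
    by (rule countable_subset[rotated]) auto
  moreover have "inj_on Map.graph {h :: assignment. finite (Map.graph h)}"
    by (rule inj_onI, rule ext) (metis in_graphI in_graphD not_None_eq)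
  ultimately have "countable {h :: assignment. finite (Map.graph h)}"
    by (rule countable_image_inj_on)
  then have "countable (\<Sigma> \<times> {h :: assignment. finite (Map.graph h)})"
    using assms by (simp add: countable_finite)
  then show ?thesis
    by (rule countable_subset[rotated]) (auto simp: universal_vars_def finite_vars mem_Times_iff)
qed

text \<open>The oblivious variants remember the fired trigger; in the standard chase, firing
  deactivates it for good because instances only grow.\<close>

lemma fired_not_applicable:
  assumes steps: "chase_steps v \<Sigma> I n Is ts" and "enat j \<le> n" "i < j"
  shows "\<not> applicable_at v \<Sigma> Is ts j (ts i)"
proof -
  have "enat i < n"
    using assms(2,3) by (metis enat_ord_simps(2) less_le_trans)
  then have "fires (ts i) (Is i) (Is (Suc i))"
    using steps by (auto simp: chase_steps_def)
  moreover have "Is (Suc i) \<subseteq> Is j"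
    using chase_steps_mono[OF steps] assms(2,3) by auto
  ultimately have "\<not> active (Is j) (ts i)"
    by (rule fires_not_active)
  then show ?thesis
    using assms(3) by (cases v) (auto simp: applicable_at_def equivalent_triggers_def)
qed

lemma applicable_imp_is_trigger: "applicable v \<Sigma> F I \<tau> \<Longrightarrow> is_trigger \<Sigma> I \<tau>"
  by (cases v) auto

text \<open>
  Always firing the applicable trigger of least index is fair: no trigger is fired twice, so only
  finitely many steps can precede a given applicable trigger.
\<close>

lemma chase_sequence_exists:
  assumes "finite \<Sigma>" "finite I"
  shows "\<exists>n Is ts. chase_sequence v \<Sigma> I n Is ts"
proof -
  define T where "T = {\<tau> :: trigger. fst \<tau> \<in> \<Sigma> \<and> dom (snd \<tau>) = universal_vars (fst \<tau>)}"
  define idx where "idx = to_nat_on T"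
  have idx: "inj_on idx T"
    unfolding idx_def by (rule inj_on_to_nat_on) (use countable_triggers[OF assms(1)] in \<open>simp add: T_def\<close>)
  define next_trigger where
    "next_trigger F J = arg_min idx (applicable v \<Sigma> F J)" for F J
  \<comment> \<open>The state pairs the fired triggers with the instance, since applicability may
    depend on both.\<close>
  define step where "step p = (case p of (F, J) \<Rightarrow>
    (insert (next_trigger F J) F, SOME K. fires (next_trigger F J) J K))" for p
  define st where "st i = (step ^^ i) ({}, I)" for i
  define Is where "Is i = snd (st i)" for i
  define ts where "ts i = next_trigger (fst (st i)) (Is i)" for i
  have st_Suc: "st (Suc i) = (insert (ts i) (fst (st i)), SOME K. fires (ts i) (Is i) K)" for i
    by (simp add: st_def Is_def ts_def step_def case_prod_beta)
  have F: "fst (st i) = ts ` {..<i}" for i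
  proof (induction i)
    case 0
    show ?case by (simp add: st_def)
  next
    case (Suc i)
    then show ?case by (simp add: st_Suc lessThan_Suc)
  qed
  define stuck where "stuck i \<longleftrightarrow> (\<forall>\<tau>. \<not> applicable_at v \<Sigma> Is ts i \<tau>)" for i
  have ts_eq: "ts i = arg_min idx (applicable v \<Sigma> (ts ` {..<i}) (Is i))" for i
    unfolding F[symmetric] by (simp add: ts_def next_trigger_def)
  have least: "applicable_at v \<Sigma> Is ts i (ts i) \<and>
      (\<forall>\<tau>. applicable_at v \<Sigma> Is ts i \<tau> \<longrightarrow> idx (ts i) \<le> idx \<tau>)" if running: "\<not> stuck i" for i
  proof -
    obtain \<sigma> where "applicable v \<Sigma> (ts ` {..<i}) (Is i) \<sigma>"
      using running unfolding stuck_def applicable_at_def by blast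
    from arg_min_nat_lemma[where P = "applicable v \<Sigma> (ts ` {..<i}) (Is i)" and m = idx, OF this] show ?thesis
      by (simp add: applicable_at_def ts_eq[symmetric])
  qed
  \<comment> \<open>The recursion runs on past a stuck state with arbitrary values, so the sequence
    is cut at the first stuck position.\<close>
  define n where "n = (if \<exists>i. stuck i then enat (LEAST i. stuck i) else \<infinity>)"
  have not_stuck: "\<not> stuck i" if "enat i < n" for i
    using that not_less_Least by (auto simp: n_def split: if_splits)
  \<comment> \<open>Finiteness travels with the induction because it guarantees the fresh nulls for
    the next step.\<close>
  have fire: "finite (Is i) \<and> (enat i < n \<longrightarrow> fires (ts i) (Is i) (Is (Suc i)))"
    if "enat i \<le> n" for i
    using that
  proof (induction i)
    have fire: "fires (ts i) (Is i) (Is (Suc i))" if "finite (Is i)" "enat i < n" for i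
    proof -
      have "is_trigger \<Sigma> (Is i) (ts i)"
        using least[OF not_stuck[OF that(2)]] applicable_imp_is_trigger
        unfolding applicable_at_def by blast
      from fires_exists[OF that(1) this] show ?thesis
        by (simp add: Is_def[of "Suc i"] st_Suc someI_ex)
    qed
    {
      case 0
      have "finite (Is 0)" using assms(2) by (simp add: Is_def st_def)
      then show ?case using fire by blast
    next
      case (Suc i)
      then have "enat i < n" by (simp add: Suc_ile_eq)
      then have "finite (Is (Suc i))" using Suc.IH fires_finite less_imp_le by blast
      then show ?case using fire by blast
    }
  qed
  have steps: "chase_steps v \<Sigma> I n Is ts"
    using fire least not_stuck by (auto simp: chase_steps_def Is_def[of 0] st_def less_imp_le)
  have "maximal v \<Sigma> n Is ts"
    using LeastI[of stuck] unfolding maximal_def n_def stuck_def by (auto split: if_splits)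
  moreover have "fair v \<Sigma> n Is ts"
    unfolding fair_def
  proof (intro impI allI)
    fix i \<tau> assume n: "n = \<infinity>" and \<tau>: "applicable_at v \<Sigma> Is ts i \<tau>"
    show "\<exists>j\<ge>i. ts j = \<tau> \<or> \<not> applicable_at v \<Sigma> Is ts j \<tau>"
    proof (rule ccontr)
      assume "\<not> ?thesis"
      \<comment> \<open>From step \<open>i\<close> on, \<open>\<tau>\<close> stays applicable and is
        thus always a competitor for the least index.\<close>
      then have le: "idx (ts j) \<le> idx \<tau>" if "j \<ge> i" for j
        using least[of j] not_stuck[of j] n that by (simp only: enat_ord_simps) blast
      have app: "applicable_at v \<Sigma> Is ts j (ts j)" for j
        using least not_stuck n by auto
      have "ts j \<in> T" for j
        using applicable_imp_is_trigger[OF app[of j, unfolded applicable_at_def]]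
        by (cases "ts j") (simp add: T_def is_trigger_def)
      moreover have "inj ts"
      proof (rule linorder_injI)
        fix k j :: nat assume "k < j"
        then have "\<not> applicable_at v \<Sigma> Is ts j (ts k)"
          using fired_not_applicable[OF steps, of j k] n by simp
        then show "ts k \<noteq> ts j"
          using app[of j] by auto
      qed
      ultimately have "inj_on (idx \<circ> ts) {i..}"
        using idx by (intro comp_inj_on) (auto intro: inj_on_subset)
      then have "infinite ((idx \<circ> ts) ` {i..})"
        using finite_imageD infinite_Ici by blast
      moreover have "(idx \<circ> ts) ` {i..} \<subseteq> {..idx \<tau>}"
        using le by auto
      ultimately show False
        using finite_subset by blast
    qed
  qed
  ultimately show ?thesis
    using steps by (auto simp: chase_sequence_def)
qed

text \<open>The existence of a chase sequence on every instance rules out that the universal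
  condition holds vacuously.\<close>

lemma CT_all_all_subset_CT_all_ex: "CT_all_all v \<subseteq> CT_all_ex v"
proof
  fix \<Sigma> assume "\<Sigma> \<in> CT_all_all v"
  moreover have "\<exists>n Is ts. chase_sequence v \<Sigma> I n Is ts"
    if "tgds_over S \<Sigma>" "instance_over S I" for S I
    using that chase_sequence_exists by (auto simp: tgds_over_def instance_over_def)
  ultimately show "\<Sigma> \<in> CT_all_ex v"
    unfolding CT_all_all_def CT_all_ex_def by blast
qed


section \<open>Separating examples\<close>

abbreviation P :: "'a \<Rightarrow> 'a atom" where
  "P u \<equiv> Atom (Rel 0 1) [u]"

abbreviation E :: "'a \<Rightarrow> 'a \<Rightarrow> 'a atom" where
  "E u v \<equiv> Atom (Rel 0 2) [u, v]"

text \<open>After \<open>i\<close> steps there are \<open>i + 1\<close> values, each giving a trigger of its own.\<close>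

lemma unary_not_in_CT_all_ex:
  assumes \<xi>: "\<xi> = Tgd [P (Var 0)] H" "P (Var 1) \<in> set H" "set H \<subseteq> {P (Var 0), P (Var 1)}"
    and stop: "\<And>F I \<tau>. is_trigger {\<xi>} I \<tau> \<Longrightarrow> \<not> applicable v {\<xi>} F I \<tau> \<Longrightarrow>
      \<exists>\<sigma>\<in>F. snd \<sigma> 0 = snd \<tau> 0"
  shows "{\<xi>} \<notin> CT_all_ex v"
proof
  assume CT: "{\<xi>} \<in> CT_all_ex v"
  have vars: "universal_vars \<xi> = {0}" "existential_vars \<xi> = {1}"
    using \<xi> by (auto simp: universal_vars_def existential_vars_def vars_def) force
  have "schema {Rel 0 1}" "tgds_over {Rel 0 1} {\<xi>}" "instance_over {Rel 0 1} {P (Const 0)}"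
    using \<xi> by (auto simp: schema_def tgds_over_def instance_over_def atom_over_def)
  then obtain n Is ts i where steps: "chase_steps v {\<xi>} {P (Const 0)} n Is ts" and i: "enat i \<le> n"
    and stuck: "\<And>\<tau>. \<not> applicable_at v {\<xi>} Is ts i \<tau>"
    using CT by (fastforce simp: CT_all_ex_def chase_sequence_def terminates_def)
  have "\<exists>V. finite V \<and> card V = Suc i \<and> Is i = P ` V"
    using i
  proof (induction i)
    case 0
    then show ?case
      using steps by (intro exI[of _ "{Const 0}"]) (auto simp: chase_steps_def)
  next
    case (Suc i)
    then have i: "enat i < n" by (simp add: Suc_ile_eq)
    then obtain V where V: "finite V" "card V = Suc i" "Is i = P ` V"
      using Suc.IH less_imp_le by blast
    have "applicable v {\<xi>} (ts ` {..<i}) (Is i) (ts i)" and fire: "fires (ts i) (Is i) (Is (Suc i))"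
      using steps i by (auto simp: chase_steps_def applicable_at_def)
    then have trig: "is_trigger {\<xi>} (Is i) (ts i)"
      using applicable_imp_is_trigger by blast
    then obtain h where h: "ts i = (\<xi>, h)"
      by (cases "ts i") (auto simp: is_trigger_def)
    then have "dom h = {0}" and P_in: "P (the (h 0)) \<in> Is i"
      using trig vars \<xi> by (simp_all add: is_trigger_def image_atoms_def)
    then obtain u where u: "h 0 = Some u"
      by blast
    then have "u \<in> V"
      using P_in V by auto
    obtain h' c where h': "extension \<xi> h h'" "h' 1 = Some (Null c)" "c \<notin> nulls (Is i)"
      "Is (Suc i) = Is i \<union> image_atoms h' (head \<xi>)"
      using fire vars by (auto simp: fires_def h)
    have "h' 0 = Some u"
      using h'(1) u by (auto simp: extension_def map_le_def dom_def)
    then have "P (Null c) \<in> image_atoms h' (head \<xi>)" "image_atoms h' (head \<xi>) \<subseteq> {P u, P (Null c)}"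
      using h'(2) \<xi> by (auto simp: image_atoms_def intro: rev_image_eqI)
    then have "Is (Suc i) = P ` insert (Null c) V"
      using h'(4) V(3) \<open>u \<in> V\<close> by blast
    moreover have "Null c \<notin> V"
      using h' V by (auto simp: nulls_def)
    ultimately show ?case
      using V by (intro exI[of _ "insert (Null c) V"]) simp
  qed
  then obtain V where V: "finite V" "card V = Suc i" "Is i = P ` V" by blast
  \<comment> \<open>As nothing is applicable after \<open>i\<close> steps, each of the
    \<open>Suc i\<close> values must be the value of variable 0 in one of only \<open>i\<close>
    fired triggers.\<close>
  have "V \<subseteq> (\<lambda>j. the (snd (ts j) 0)) ` {..<i}"
  proof
    fix u assume "u \<in> V"
    then have "is_trigger {\<xi>} (Is i) (\<xi>, [0 \<mapsto> u])"
      using V \<xi> vars by (auto simp: is_trigger_def image_atoms_def)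
    then have "\<exists>\<sigma>\<in>ts ` {..<i}. snd \<sigma> 0 = Some u"
      using stop[of "Is i" "(\<xi>, [0 \<mapsto> u])" "ts ` {..<i}"] stuck by (auto simp: applicable_at_def)
    then show "u \<in> (\<lambda>j. the (snd (ts j) 0)) ` {..<i}"
      by force
  qed
  then have "card V \<le> card {..<i}"
    by (meson card_image_le card_mono finite_imageI finite_lessThan le_trans)
  then show False using V by simp
qed

definition obl_sobl_separator :: tgd where
  "obl_sobl_separator = Tgd [P (Var 0)] [P (Var 1)]"

text \<open>Repeating the body atom in the head puts variable 0 on the frontier, so different values
  give inequivalent triggers.\<close>

definition sobl_std_separator :: tgd where
  "sobl_std_separator = Tgd [P (Var 0)] [P (Var 0), P (Var 1)]"

lemma obl_sobl_separator_not_Obl: "{obl_sobl_separator} \<notin> CT_all_ex Obl"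
  by (rule unary_not_in_CT_all_ex) (auto simp: obl_sobl_separator_def)

lemma sobl_std_separator_not_Sobl: "{sobl_std_separator} \<notin> CT_all_ex Sobl"
proof (rule unary_not_in_CT_all_ex)
  have "0 \<in> frontier_vars sobl_std_separator"
    by (simp add: frontier_vars_def vars_def sobl_std_separator_def)
  moreover have "fst \<tau> = sobl_std_separator" if "is_trigger {sobl_std_separator} I \<tau>" for I \<tau>
    using that by (cases \<tau>) (simp add: is_trigger_def)
  ultimately show "\<exists>\<sigma>\<in>F. snd \<sigma> 0 = snd \<tau> 0" if "is_trigger {sobl_std_separator} I \<tau>"
    "\<not> applicable Sobl {sobl_std_separator} F I \<tau>" for F I \<tau>
    using that unfolding applicable.simps equivalent_triggers_def by metis
qed (auto simp: sobl_std_separator_def)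

lemma unary_tgds_over: "\<exists>S. schema S \<and> tgds_over S {obl_sobl_separator}"
  "\<exists>S. schema S \<and> tgds_over S {sobl_std_separator}"
  by (rule exI[of _ "{Rel 0 1}"];
      simp add: schema_def tgds_over_def atom_over_def obl_sobl_separator_def sobl_std_separator_def)+

text \<open>The frontier is empty, so all triggers are equivalent.\<close>

lemma obl_sobl_separator_Sobl: "{obl_sobl_separator} \<in> CT_all_all Sobl"
proof -
  have "terminates Sobl {obl_sobl_separator} n Is ts"
    if "chase_sequence Sobl {obl_sobl_separator} I n Is ts" for I n Is ts
  proof (cases "n = 0")
    case True
    then show ?thesis
      using that by (auto simp: chase_sequence_def maximal_def terminates_def zero_enat_def)
  next
    case False
    then have n: "enat 0 < n" by (simp flip: zero_enat_def)
    have "frontier_vars obl_sobl_separator = {}"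
      by (auto simp: frontier_vars_def vars_def obl_sobl_separator_def)
    moreover have "is_trigger {obl_sobl_separator} (Is 0) (ts 0)"
      using that n by (auto simp: chase_sequence_def chase_steps_def applicable_at_def)
    ultimately have "\<not> applicable_at Sobl {obl_sobl_separator} Is ts 1 \<tau>" for \<tau>
      by (auto simp: applicable_at_def is_trigger_def equivalent_triggers_def split: prod.splits)
    moreover have "enat 1 \<le> n" using n by (simp only: One_nat_def Suc_ile_eq)
    ultimately show ?thesis
      unfolding terminates_def by blast
  qed
  then show ?thesis
    using unary_tgds_over(1) by (auto simp: CT_all_all_def)
qed

lemma sobl_std_separator_Std: "{sobl_std_separator} \<in> CT_all_all Std"
proof -
  have "\<not> active I \<tau>" if trig: "is_trigger {sobl_std_separator} I \<tau>" for I \<tau>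
  proof -
    obtain h where \<tau>: "\<tau> = (sobl_std_separator, h)" using trig by (cases \<tau>) (auto simp: is_trigger_def)
    have h: "dom h = {0}" "P (the (h 0)) \<in> I"
      using trig by (auto simp: \<tau> is_trigger_def sobl_std_separator_def universal_vars_def vars_def
          image_atoms_def)
    \<comment> \<open>The body match itself satisfies the head once the existential variable takes
      the value of variable 0, so no trigger is ever active.\<close>
    have "extension sobl_std_separator h (h(1 := h 0))"
      using h by (auto simp: extension_def sobl_std_separator_def universal_vars_def
          existential_vars_def vars_def map_le_def dom_def)
    moreover have "image_atoms (h(1 := h 0)) (head sobl_std_separator) \<subseteq> I"
      using h by (auto simp: image_atoms_def sobl_std_separator_def)
    ultimately show ?thesis
      by (auto simp: active_def \<tau>)
  qed
  then have "terminates Std {sobl_std_separator} n Is ts" for n Is ts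
    unfolding terminates_def by (intro exI[of _ 0]) (auto simp: applicable_at_def zero_enat_def[symmetric])
  then show ?thesis
    using unary_tgds_over(2) by (auto simp: CT_all_all_def)
qed

section \<open>Standard chase: all sequences versus some sequence\<close>

definition successor_tgd :: tgd where
  "successor_tgd = Tgd [E (Var 0) (Var 1)] [E (Var 1) (Var 2)]"

text \<open>A loop at \<open>v\<close> satisfies the heads of both dependencies for every edge
  ending in \<open>v\<close>, so the order of firing decides whether new vertices are
  created.\<close>

definition loop_tgd :: tgd where
  "loop_tgd = Tgd [E (Var 0) (Var 1)] [E (Var 1) (Var 1)]"

abbreviation edge :: "val \<Rightarrow> val \<Rightarrow> assignment" where
  "edge u v \<equiv> [0 \<mapsto> u, Suc 0 \<mapsto> v]"

lemma binary_vars [simp]: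
  "universal_vars successor_tgd = {0, 1}" "existential_vars successor_tgd = {2}"
  "universal_vars loop_tgd = {0, 1}" "existential_vars loop_tgd = {}"
  by (auto simp: universal_vars_def existential_vars_def vars_def successor_tgd_def loop_tgd_def)

lemma map_le_dom_eq: "g \<subseteq>\<^sub>m h \<Longrightarrow> dom h \<subseteq> dom g \<Longrightarrow> h = g"
  by (rule map_le_antisym) (auto simp: map_le_def dom_def)

lemma edge_le: "edge u v \<subseteq>\<^sub>m h \<longleftrightarrow> h 0 = Some u \<and> h (Suc 0) = Some v"
  by (auto simp: map_le_def)

lemma is_trigger_binary:
  "is_trigger {successor_tgd, loop_tgd} I \<tau> \<longleftrightarrow>
    (\<exists>\<xi> u v. \<tau> = (\<xi>, edge u v) \<and> \<xi> \<in> {successor_tgd, loop_tgd} \<and> E u v \<in> I)"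
  (is "?L \<longleftrightarrow> ?R")
proof
  assume ?L
  then obtain \<xi> h where \<tau>: "\<tau> = (\<xi>, h)" "\<xi> \<in> {successor_tgd, loop_tgd}" "dom h = {0, 1}"
    "E (the (h 0)) (the (h 1)) \<in> I"
    by (auto simp: is_trigger_def image_atoms_def, auto simp: successor_tgd_def loop_tgd_def)
  have "0 \<in> dom h" "Suc 0 \<in> dom h"
    using \<tau>(3) by simp_all
  then obtain u v where uv: "h 0 = Some u" "h (Suc 0) = Some v"
    by blast
  then have "h = edge u v"
    by (intro map_le_dom_eq) (simp_all add: edge_le \<tau>(3))
  moreover have "E u v \<in> I"
    using \<tau>(4) uv by simp
  ultimately show ?R
    using \<tau>(1,2) by blast
next
  assume ?R
  then show ?L
    by (auto simp: is_trigger_def image_atoms_def split: if_splits)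
      (auto simp: successor_tgd_def loop_tgd_def)
qed

lemma extension_loop: "extension loop_tgd (edge u v) h' \<longleftrightarrow> h' = edge u v"
  using map_le_dom_eq[of "edge u v" h'] by (auto simp: extension_def split: if_splits)

lemma extension_successor:
  "extension successor_tgd (edge u v) h' \<longleftrightarrow> (\<exists>w. h' = (edge u v)(2 \<mapsto> w))"
proof
  assume ext: "extension successor_tgd (edge u v) h'"
  then have "2 \<in> dom h'"
    by (auto simp: extension_def)
  then obtain w where "h' 2 = Some w" by blast
  then have "(edge u v)(2 \<mapsto> w) \<subseteq>\<^sub>m h'"
    using ext by (auto simp: extension_def map_le_def)
  moreover have "dom h' \<subseteq> dom ((edge u v)(2 \<mapsto> w))"
    using ext by (auto simp: extension_def)
  ultimately show "\<exists>w. h' = (edge u v)(2 \<mapsto> w)"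
    using map_le_dom_eq by blast
qed (auto simp: extension_def map_le_def split: if_splits)

lemma active_loop: "active I (loop_tgd, edge u v) \<longleftrightarrow> E v v \<notin> I"
  by (simp add: active_def extension_loop image_atoms_def) (simp add: loop_tgd_def)

lemma active_successor: "active I (successor_tgd, edge u v) \<longleftrightarrow> (\<forall>w. E v w \<notin> I)"
  by (auto simp: active_def extension_successor image_atoms_def) (auto simp: successor_tgd_def)

lemma fires_loop: "fires (loop_tgd, edge u v) I (insert (E v v) I)"
  by (simp add: fires_def extension_loop image_atoms_def) (simp add: loop_tgd_def)

lemma fires_successor:
  "c \<notin> nulls I \<Longrightarrow> fires (successor_tgd, edge u v) I (insert (E v (Null c)) I)"
  by (auto simp: fires_def extension_successor image_atoms_def intro!: exI[of _ "(edge u v)(2 \<mapsto> Null c)"])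
    (auto simp: successor_tgd_def)

text \<open>Standard applicability is decided by the current instance, so a step can be put in front
  of a sequence without disturbing the later ones.\<close>

lemma Std_terminating_step:
  assumes "applicable Std \<Sigma> {} I \<tau>" "fires \<tau> I J"
    and "chase_sequence Std \<Sigma> J (enat m) Js ts"
  shows "chase_sequence Std \<Sigma> I (enat (Suc m)) (case_nat I Js) (case_nat \<tau> ts)"
  using assms
  by (auto simp: chase_sequence_def chase_steps_def maximal_def fair_def applicable_at_def split: nat.split)

text \<open>The measure counts the edge targets without a loop. Firing \<open>loop_tgd\<close>
  removes one and creates no new target; when none is left, neither dependency has an active
  trigger.\<close>

lemma loops_first:
  assumes "finite I"
  shows "\<exists>m Is ts. chase_sequence Std {successor_tgd, loop_tgd} I (enat m) Is ts"
  using assms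
proof (induction "card {v. \<exists>u. E u v \<in> I \<and> E v v \<notin> I}" arbitrary: I rule: less_induct)
  case less
  let ?M = "\<lambda>I. {v. \<exists>u. E u v \<in> I \<and> E v v \<notin> I} :: val set"
  show ?case
  proof (cases "?M I = {}")
    case True
    then have "\<not> applicable_at Std {successor_tgd, loop_tgd} (\<lambda>_. I) ts 0 \<tau>" for ts \<tau>
      by (auto simp: applicable_at_def is_trigger_binary active_loop active_successor)
    then show ?thesis
      by (intro exI[of _ 0] exI[of _ "\<lambda>_. I"])
        (auto simp: chase_sequence_def chase_steps_def maximal_def fair_def)
  next
    case False
    then obtain u v where uv: "E u v \<in> I" "E v v \<notin> I" by blast
    let ?J = "insert (E v v) I"
    have "?M I \<subseteq> (\<lambda>A. args A ! 1) ` I"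
      by force
    then have "finite (?M I)"
      using less.prems finite_subset by blast
    moreover have "?M ?J \<subset> ?M I"
      using uv by auto
    ultimately have "card (?M ?J) < card (?M I)"
      by (rule psubset_card_mono)
    then obtain m Js ts where "chase_sequence Std {successor_tgd, loop_tgd} ?J (enat m) Js ts"
      using less.hyps[of ?J] less.prems by auto
    moreover have "applicable Std {successor_tgd, loop_tgd} {} I (loop_tgd, edge u v)"
      using uv by (auto simp: is_trigger_binary active_loop)
    ultimately show ?thesis
      using Std_terminating_step fires_loop by blast
  qed
qed

lemma binary_tgds_over:
  "schema {Rel 0 2}" "tgds_over {Rel 0 2} {successor_tgd, loop_tgd}"
  by (auto simp: schema_def tgds_over_def atom_over_def successor_tgd_def loop_tgd_def)

lemma successor_loop_Std_ex: "{successor_tgd, loop_tgd} \<in> CT_all_ex Std"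
proof -
  have "\<exists>n Is ts. chase_sequence Std {successor_tgd, loop_tgd} I n Is ts \<and>
      terminates Std {successor_tgd, loop_tgd} n Is ts" if fin: "finite I" for I
  proof -
    obtain m Is ts where seq: "chase_sequence Std {successor_tgd, loop_tgd} I (enat m) Is ts"
      using loops_first[OF fin] by blast
    then have "terminates Std {successor_tgd, loop_tgd} (enat m) Is ts"
      by (auto simp: chase_sequence_def maximal_def terminates_def)
    with seq show ?thesis by blast
  qed
  then show ?thesis
    using binary_tgds_over by (auto simp: CT_all_ex_def instance_over_def)
qed

text \<open>
  Alternating the two dependencies, with the successor of \<open>Null (Suc k)\<close> created before its loop,
  yields an infinite chase.
\<close>

lemma successor_loop_not_Std_all: "{successor_tgd, loop_tgd} \<notin> CT_all_all Std"
proof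
  let ?\<Sigma> = "{successor_tgd, loop_tgd}"
  assume CT: "?\<Sigma> \<in> CT_all_all Std"
  \<comment> \<open>An even step \<open>2 * k\<close> adds the edge leaving
    \<open>Null (Suc k)\<close>, and the following odd step adds the loop at
    \<open>Null (Suc k)\<close>. The newest vertex thus has no outgoing edge when its successor is
    due.\<close>
  define Is where "Is m = (\<lambda>i. E (Null i) (Null (Suc i))) ` {..Suc m div 2} \<union>
    (\<lambda>i. E (Null (Suc i)) (Null (Suc i))) ` {..<m div 2}" for m
  define ts where "ts m = (if even m then successor_tgd else loop_tgd,
    edge (Null (m div 2)) (Null (Suc (m div 2))))" for m
  have step: "applicable_at Std ?\<Sigma> Is ts m (ts m) \<and> fires (ts m) (Is m) (Is (Suc m))" for m
  proof -
    have "E (Null (m div 2)) (Null (Suc (m div 2))) \<in> Is m"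
      by (auto simp: Is_def div_le_mono)
    then have trig: "is_trigger ?\<Sigma> (Is m) (ts m)"
      unfolding is_trigger_binary ts_def by (intro exI conjI) (rule refl, simp_all)
    show ?thesis
    proof (cases "even m")
      case True
      then obtain k where m: "m = 2 * k" by blast
      have "Suc (Suc k) \<notin> nulls (Is m)"
        by (auto simp: nulls_def Is_def m)
      moreover have "Is (Suc m) = insert (E (Null (Suc k)) (Null (Suc (Suc k)))) (Is m)"
        by (auto simp: Is_def m atMost_Suc)
      ultimately have "fires (ts m) (Is m) (Is (Suc m))"
        using fires_successor by (simp add: ts_def m)
      moreover have "active (Is m) (ts m)"
        by (auto simp: ts_def m active_successor) (auto simp: Is_def)
      ultimately show ?thesis
        using trig by (simp add: applicable_at_def)
    next
      case False
      then obtain k where m: "m = Suc (2 * k)" by (auto elim: oddE)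
      have "Is (Suc m) = insert (E (Null (Suc k)) (Null (Suc k))) (Is m)"
        by (auto simp: Is_def m lessThan_Suc)
      then have "fires (ts m) (Is m) (Is (Suc m))"
        using fires_loop by (simp add: ts_def m)
      moreover have "active (Is m) (ts m)"
        by (auto simp: ts_def m active_loop) (auto simp: Is_def)
      ultimately show ?thesis
        using trig by (simp add: applicable_at_def)
    qed
  qed
  \<comment> \<open>Fairness: every edge ends in some \<open>Null (Suc p)\<close>, whose loop is
    present from step \<open>2 * Suc p\<close> on and deactivates all triggers for edges ending
    there.\<close>
  have "\<exists>j\<ge>i. \<not> applicable_at Std ?\<Sigma> Is ts j \<tau>" if \<tau>: "applicable_at Std ?\<Sigma> Is ts i \<tau>" for i \<tau>
  proof -
    obtain \<xi> u v where uv: "\<tau> = (\<xi>, edge u v)" "\<xi> \<in> ?\<Sigma>" "E u v \<in> Is i"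
      using \<tau> by (auto simp: applicable_at_def is_trigger_binary)
    then obtain p where v: "v = Null (Suc p)" by (auto simp: Is_def)
    have "E v v \<in> Is (max i (2 * Suc p))"
      unfolding v Is_def by (intro UnI2 image_eqI[OF refl]) auto
    then have "\<not> applicable_at Std ?\<Sigma> Is ts (max i (2 * Suc p)) \<tau>"
      using uv by (auto simp: applicable_at_def active_loop active_successor)
    then show ?thesis by (meson max.cobounded1)
  qed
  then have "chase_sequence Std ?\<Sigma> (Is 0) \<infinity> Is ts"
    using step unfolding chase_sequence_def chase_steps_def maximal_def fair_def by blast
  moreover have "instance_over {Rel 0 2} (Is 0)"
    by (auto simp: instance_over_def atom_over_def Is_def)
  ultimately have "terminates Std ?\<Sigma> \<infinity> Is ts"
    using CT binary_tgds_over unfolding CT_all_all_def by blast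
  then show False
    using step unfolding terminates_def by blast
qed

theorem theorem2:
  shows "CT_all_all Obl = CT_all_ex Obl \<and>
         CT_all_ex Obl \<subset> CT_all_all Sobl \<and>
         CT_all_all Sobl = CT_all_ex Sobl \<and>
         CT_all_ex Sobl \<subset> CT_all_all Std \<and>
         CT_all_all Std \<subset> CT_all_ex Std"
proof (intro conjI equalityI psubsetI)
  show "CT_all_ex Obl \<noteq> CT_all_all Sobl"
    using obl_sobl_separator_not_Obl obl_sobl_separator_Sobl by blast
  show "CT_all_ex Sobl \<noteq> CT_all_all Std"
    using sobl_std_separator_not_Sobl sobl_std_separator_Std by blast
  show "CT_all_all Std \<noteq> CT_all_ex Std"
    using successor_loop_not_Std_all successor_loop_Std_ex by blast
qed (rule CT_all_ex_Obl_subset CT_all_ex_Sobl_subset CT_all_all_subset_CT_all_ex)+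

end
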